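(* $N(54) \ge 8$; that is, there exist $8$ mutually orthogonal Latin squares of order $54$.
   Context: Let $n$ be a positive integer. A Latin square of order $n$ on an $n$-element set $V$ is an $n \times n$ array with entries in $V$ such that every row and every column is a permutation of $V$. Two Latin squares $L_1=(v_{ij})$ on $V$ and $L_2=(w_{ij})$ on $W$ (with $|V|=|W|=n$) are called orthogonal if the set of all entries of the array $((v_{ij},w_{ij}))$ is the whole Cartesian product $V\times W$. A set of $t$ mutually orthogonal Latin squares (MOLS) of order $n$ consists of $t$ Latin squares of order $n$ which are pairwise orthogonal. $N(n)$ denotes the size of the largest set of MOLS of order $n$. *)

theory Defs
  imports Main "HOL-Library.Extended_Nat"
begin

text \<open>
  An \<open>n \<times> n\<close> array is a function of its row and column index; only the values at indices
  below \<open>n\<close> matter.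
\<close>

definition latin_square :: "nat \<Rightarrow> 'a set \<Rightarrow> (nat \<Rightarrow> nat \<Rightarrow> 'a) \<Rightarrow> bool" where
  "latin_square n V L \<longleftrightarrow>
     0 < n \<and> finite V \<and> card V = n \<and>
     (\<forall>i<n. bij_betw (\<lambda>j. L i j) {..<n} V) \<and>
     (\<forall>j<n. bij_betw (\<lambda>i. L i j) {..<n} V)"

definition orthogonal_squares ::
    "nat \<Rightarrow> (nat \<Rightarrow> nat \<Rightarrow> 'a) \<Rightarrow> (nat \<Rightarrow> nat \<Rightarrow> 'b) \<Rightarrow> bool" where
  "orthogonal_squares n L1 L2 \<longleftrightarrow>
     (\<exists>V W. latin_square n V L1 \<and> latin_square n W L2 \<and>
            {(L1 i j, L2 i j) | i j. i < n \<and> j < n} = V \<times> W)"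

text \<open>
  The squares of a set of MOLS may have different symbol sets. For \<open>n \<ge> 2\<close> no array is
  orthogonal to itself, so functions that agree at all indices below \<open>n\<close> but differ elsewhere
  cannot both belong to a set of MOLS.
\<close>

definition mols :: "nat \<Rightarrow> (nat \<Rightarrow> nat \<Rightarrow> 'a) set \<Rightarrow> bool" where
  "mols n M \<longleftrightarrow>
     (\<forall>L\<in>M. \<exists>V. latin_square n V L) \<and> pairwise (orthogonal_squares n) M"

text \<open>
  Symbols can be taken to be natural numbers, since every symbol set is finite. The supremum
  is formed in \<^typ>\<open>enat\<close>: for \<open>n \<ge> 2\<close> the sizes are bounded by \<open>n - 1\<close> and it is
  their maximum, whereas for \<open>n = 1\<close> they are unbounded and it is \<open>\<infinity>\<close>.
\<close>

definition max_mols :: "nat \<Rightarrow> enat" where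
  "max_mols n = Sup {enat (card M) | M :: (nat \<Rightarrow> nat \<Rightarrow> nat) set. finite M \<and> mols n M}"

end

theory Submission
  imports Defs "HOL-Library.Numeral_Type" "HOL-Library.Product_Plus"
begin

text \<open>
  Eight MOLS of order \<open>54\<close> amount to an orthogonal array with ten rows: a set of \<open>54\<^sup>2\<close>
  blocks and ten maps from the blocks to a set of \<open>54\<close> symbols, any two of which jointly
  separate the blocks. Two rows index the cells of the squares, and the other eight are the
  squares (\<open>orthogonal_array_imp_mols\<close>). The ten rows are taken from an array with rows
  \<open>0, \<dots>, 10\<close> that is invariant under the translations of \<open>GF(3)\<^sup>5\<close> and under an automorphism
  that permutes the eleven rows cyclically. This makes it small enough to write down.

  Let \<open>P = GF(3)\<^sup>5\<close>, on which the companion matrix \<open>T\<close> of \<open>x\<^sup>5 - x\<^sup>3 + x\<^sup>2 - x - 1\<close> acts.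
  This polynomial divides \<open>x\<^sup>1\<^sup>1 - 1\<close>, so that \<open>T\<close> has order \<open>11\<close>. The \<open>54\<close> symbols form two
  sheets of \<open>27\<close>, each a copy of \<open>GF(3)\<^sup>3\<close>, and the \<open>54\<^sup>2 = 12 \<cdot> 243\<close> blocks are
  the pairs of one of twelve columns \<open>k\<close> and a vector \<open>p \<in> P\<close>. Row \<open>0\<close> sends the block
  \<open>(k, p)\<close> to the symbol \<open>A\<^sub>s p + c\<^sub>k\<close> on sheet \<open>s\<close>, where \<open>s = s(k)\<close> depends on the
  column, and \<open>A\<^sub>0\<close>, \<open>A\<^sub>1\<close> are two fixed linear maps of \<open>P\<close> onto \<open>GF(3)\<^sup>3\<close>. Row \<open>i\<close>
  is row \<open>0\<close> evaluated at the block \<open>(k + i, T\<^sup>i p)\<close>, where eleven of the columns are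
  rotated modulo \<open>11\<close> and the twelfth stays fixed. Hence the rows \<open>i < j\<close> are related to each
  other in the same way as the rows \<open>0\<close> and \<open>d = j - i\<close>.

  The assignment of sheets to columns is that of the Paley Hadamard matrix of order \<open>12\<close> (the
  quadratic residues modulo \<open>11\<close> and the fixed column have one sheet, the other columns have
  the other sheet). So for any two rows each of the four pairs of sheets \<open>(s, t)\<close> occurs
  in exactly three columns. The two planes \<open>ker A\<^sub>s\<close> and \<open>ker (A\<^sub>t T\<^sup>d)\<close> meet only in \<open>0\<close>,
  whence two blocks of one column are separated. These two planes span a hyperplane of \<open>P\<close>, so the
  six coordinates of the symbols in rows \<open>0\<close> and \<open>d\<close> satisfy, up to a constant depending on the
  column, one linear relation; the offsets \<open>c\<^sub>k\<close> are such that the three columns give the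
  three possible constants, and so blocks of different columns are separated too.

  Three elements of \<open>GF(3)\<close> are different if and only if they sum to \<open>0\<close> and are not all equal. So
  the offsets are a solution of a homogeneous linear system that avoids some hyperplanes. As
  everything is affine over \<open>GF(3)\<close>, the array is verified by solving, for each pair of columns with
  the same sheets in rows \<open>0\<close> and \<open>d\<close>, two linear equations for the difference of two vectors.
  This is a finite computation for each \<open>d\<close> from \<open>1\<close> to \<open>10\<close> (\<open>separates_1_to_10\<close>).
\<close>

section \<open>Orthogonal arrays and Latin squares\<close>

text \<open>
  A pair of rows that separates the \<open>n\<^sup>2\<close> blocks takes every pair of symbols exactly once. So the
  last two rows identify the blocks with the cells of an array, and each of the other rows
  fills this array. That row \<open>k\<close> gives a Latin square is its orthogonality to the two
  rows of indices. For \<open>n \<ge> 2\<close> orthogonality makes the squares different, which yields the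
  cardinality of the set.
\<close>

lemma orthogonal_array_imp_mols:
  fixes r :: "nat \<Rightarrow> 'b \<Rightarrow> 'v"
  assumes n: "n \<ge> 2"
    and B: "finite B" "card B = n ^ 2"
    and V: "finite V" "card V = n"
    and r: "\<And>i x. i < m + 2 \<Longrightarrow> x \<in> B \<Longrightarrow> r i x \<in> V"
    and inj: "\<And>i j. i < j \<Longrightarrow> j < m + 2 \<Longrightarrow> inj_on (\<lambda>x. (r i x, r j x)) B"
  shows "\<exists>M :: (nat \<Rightarrow> nat \<Rightarrow> nat) set. finite M \<and> card M = m \<and> mols n M"
proof -
  obtain e where e: "bij_betw e V {..<n}"
    using finite_same_card_bij[of V "{..<n}"] V by auto
  define R where "R i x = e (r i x)" for i x
  have R_less: "R i x < n" if "i < m + 2" "x \<in> B" for i x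
    using e r[OF that] by (auto simp: R_def bij_betw_def)
  have R_cong: "x = y"
    if "i \<noteq> j" "i < m + 2" "j < m + 2" "x \<in> B" "y \<in> B" "R i x = R i y" "R j x = R j y"
    for i j x y
  proof -
    have "r i x = r i y" "r j x = r j y"
      using that r bij_betw_imp_inj_on[OF e] by (auto simp: R_def inj_on_def)
    then show ?thesis
      using inj[of i j] inj[of j i] that by (cases "i < j") (auto simp: inj_on_def)
  qed
  have bij: "bij_betw (\<lambda>x. (R i x, R j x)) B ({..<n} \<times> {..<n})"
    if "i \<noteq> j" "i < m + 2" "j < m + 2" for i j
  proof -
    have i: "inj_on (\<lambda>x. (R i x, R j x)) B"
      using R_cong that by (auto intro!: inj_onI)
    have "(\<lambda>x. (R i x, R j x)) ` B = {..<n} \<times> {..<n}"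
    proof (rule card_subset_eq)
      show "(\<lambda>x. (R i x, R j x)) ` B \<subseteq> {..<n} \<times> {..<n}"
        using R_less that by auto
      show "card ((\<lambda>x. (R i x, R j x)) ` B) = card ({..<n} \<times> {..<n})"
        using B by (simp add: card_image[OF i] power2_eq_square)
    qed simp
    with i show ?thesis by (simp add: bij_betw_def)
  qed
  define blk where "blk a b = the_inv_into B (\<lambda>x. (R m x, R (Suc m) x)) (a, b)" for a b
  have index: "bij_betw (\<lambda>x. (R m x, R (Suc m) x)) B ({..<n} \<times> {..<n})"
    using bij[of m "Suc m"] by simp
  have blk: "blk a b \<in> B" "R m (blk a b) = a" "R (Suc m) (blk a b) = b" if "a < n" "b < n" for a b
    using that bij_betwE[OF bij_betw_the_inv_into[OF index]]
      f_the_inv_into_f_bij_betw[OF index, of "(a, b)"]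
    by (auto simp: blk_def)
  define L where "L k a b = R k (blk a b)" for k a b
  have L_less: "L k a b < n" if "k < m" "a < n" "b < n" for k a b
    using that blk R_less by (simp add: L_def)
  have bij_if_inj: "bij_betw f {..<n} {..<n}" if "inj_on f {..<n}" "\<And>a. a < n \<Longrightarrow> f a < n" for f
    using that endo_inj_surj[of "{..<n}" f] by (auto simp: bij_betw_def)
  have latin: "latin_square n {..<n} (L k)" if k: "k < m" for k
    unfolding latin_square_def
  proof (intro conjI allI impI)
    fix a assume a: "a < n"
    have "inj_on (L k a) {..<n}"
      using R_cong[of m k "blk a _" "blk a _"] blk a k unfolding L_def inj_on_def
      by (metis add_2_eq_Suc' lessThan_iff less_SucI less_irrefl lessI)
    then show "bij_betw (L k a) {..<n} {..<n}"
      using bij_if_inj L_less a k by blast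
    have "inj_on (\<lambda>i. L k i a) {..<n}"
      using R_cong[of "Suc m" k "blk _ a" "blk _ a"] blk a k unfolding L_def inj_on_def
      by (metis add_2_eq_Suc' lessThan_iff less_SucI less_irrefl lessI)
    then show "bij_betw (\<lambda>i. L k i a) {..<n} {..<n}"
      using bij_if_inj[of "\<lambda>i. L k i a"] L_less a k by blast
  qed (use n in auto)
  have pairs: "{(L k i j, L l i j) | i j. i < n \<and> j < n} = {..<n} \<times> {..<n}"
    if "k \<noteq> l" "k < m" "l < m" for k l
  proof
    show "{(L k i j, L l i j) | i j. i < n \<and> j < n} \<subseteq> {..<n} \<times> {..<n}"
      using that L_less by auto
    show "{..<n} \<times> {..<n} \<subseteq> {(L k i j, L l i j) | i j. i < n \<and> j < n}"
    proof
      fix z assume "z \<in> {..<n} \<times> {..<n}"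
      also have "\<dots> = (\<lambda>x. (R k x, R l x)) ` B"
        using bij[of k l] that by (simp add: bij_betw_def)
      finally obtain x where x: "x \<in> B" "z = (R k x, R l x)" by blast
      let ?a = "R m x" and ?b = "R (Suc m) x"
      have ab: "?a < n" "?b < n" using x R_less by auto
      then have "blk ?a ?b = x"
        using R_cong[of m "Suc m" "blk ?a ?b" x] blk x by auto
      then have "z = (L k ?a ?b, L l ?a ?b)"
        using x by (simp add: L_def)
      with ab show "z \<in> {(L k i j, L l i j) | i j. i < n \<and> j < n}" by blast
    qed
  qed
  have orthogonal: "orthogonal_squares n (L k) (L l)" if "L k \<noteq> L l" "k < m" "l < m" for k l
    unfolding orthogonal_squares_def
    by (intro exI[of _ "{..<n}"] conjI latin pairs) (use that in auto)
  have "inj_on L {..<m}"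
  proof (rule inj_onI, rule ccontr)
    fix k l assume kl: "k \<in> {..<m}" "l \<in> {..<m}" "L k = L l" "k \<noteq> l"
    have "(0, 1) \<in> {(L k i j, L l i j) | i j. i < n \<and> j < n}"
      using pairs[of k l] kl n by simp
    with kl(3) show False by auto
  qed
  then have "card (L ` {..<m}) = m"
    by (simp add: card_image)
  moreover have "mols n (L ` {..<m})"
    unfolding mols_def pairwise_def using latin orthogonal by auto
  ultimately show ?thesis
    by blast
qed

section \<open>The array over GF(3)\<close>

type_synonym gf3 = "3"
type_synonym vec3 = "gf3 \<times> gf3 \<times> gf3"
type_synonym vec5 = "gf3 \<times> gf3 \<times> gf3 \<times> gf3 \<times> gf3"

text \<open>The matrix \<open>T\<close>, as one step of a linear feedback shift register of period \<open>11\<close>.\<close>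

definition feedback_shift :: "vec5 \<Rightarrow> vec5" where
  "feedback_shift = (\<lambda>(v, w, x, y, z). (w, x, y, z, v + w - x + y))"

text \<open>
  The maps \<open>A\<^sub>1\<close> (for \<^const>\<open>True\<close>) and \<open>A\<^sub>0\<close>. They are chosen such that all the planes
  \<open>ker (A\<^sub>s T\<^sup>i)\<close> with different \<open>i\<close> in \<open>{0..10}\<close> and arbitrary \<open>s\<close> meet only in \<open>0\<close>.
\<close>

definition coords :: "bool \<Rightarrow> vec5 \<Rightarrow> vec3" where
  "coords s = (\<lambda>(v, w, x, y, z). if s then (v, x, y) else (v + x, v + y, z))"

text \<open>Column \<open>11\<close> is the fixed one; the other members are the quadratic residues modulo \<open>11\<close>.\<close>

definition sheet :: "nat \<Rightarrow> bool" where
  "sheet k \<longleftrightarrow> k \<in> {1, 3, 4, 5, 9, 11}"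

text \<open>
  The vectors \<open>c\<^sub>k\<close>, one of many solutions of twenty linear equations and twenty inequalities: one
  of each for every pair of sheets and every \<open>d \<in> {1..5}\<close>, as \<open>d\<close> and \<open>11 - d\<close> give the same ones.
\<close>

definition offset :: "nat \<Rightarrow> vec3" where
  "offset k =
     [(0, 0, 0), (0, 0, 0), (1, 1, 1), (0, 1, 0), (0, 0, 1), (0, 0, 0),
      (2, 0, 0), (1, 0, 0), (0, 0, 1), (0, 0, 2), (0, 0, 2), (0, 2, 1)] ! k"

definition rotate_column :: "nat \<Rightarrow> nat \<Rightarrow> nat" where
  "rotate_column d k = (if k = 11 then 11 else (k + d) mod 11)"

definition symbol :: "nat \<Rightarrow> vec5 \<Rightarrow> bool \<times> vec3" where
  "symbol k p = (sheet k, coords (sheet k) p + offset k)"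

definition array_row :: "nat \<Rightarrow> nat \<times> vec5 \<Rightarrow> bool \<times> vec3" where
  "array_row i = (\<lambda>(k, p). symbol (rotate_column i k) ((feedback_shift ^^ i) p))"

lemma UNIV_gf3: "(UNIV :: gf3 set) = {0, 1, 2}"
proof -
  have "card {0, 1, 2 :: gf3} = CARD(gf3)" by simp
  then show ?thesis by (metis card_subset_eq finite subset_UNIV)
qed

lemma all_gf3: "(\<forall>x :: gf3. P x) \<longleftrightarrow> P 0 \<and> P 1 \<and> P 2"
  using UNIV_gf3 by (metis UNIV_I insertE singletonD)

lemma coords_diff: "coords s (p - q) = coords s p - coords s q"
  by (cases p; cases q) (auto simp: coords_def)

lemma feedback_shift_diff: "feedback_shift (p - q) = feedback_shift p - feedback_shift q"
  by (cases p; cases q) (simp add: feedback_shift_def)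

lemma feedback_shift_pow_diff:
  "(feedback_shift ^^ d) (p - q) = (feedback_shift ^^ d) p - (feedback_shift ^^ d) q"
  by (induction d) (simp_all add: feedback_shift_diff)

lemma inj_feedback_shift_pow: "inj (feedback_shift ^^ d)"
proof -
  have "inj feedback_shift"
    by (auto simp: inj_def feedback_shift_def)
  then show ?thesis by (induction d) (auto intro: inj_compose)
qed

lemma rotate_column_add: "rotate_column d (rotate_column i k) = rotate_column (i + d) k"
proof -
  have "m mod 11 \<noteq> 11" for m :: nat
    using mod_less_divisor[of 11 m] by linarith
  then show ?thesis by (simp add: rotate_column_def mod_simps add.assoc)
qed

lemma rotate_column_less: "k < 12 \<Longrightarrow> rotate_column d k < 12"
  using mod_less_divisor[of 11 "k + d"] by (auto simp: rotate_column_def)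

lemma inj_on_rotate_column: "inj_on (rotate_column i) {..<12}"
proof (rule inj_onI)
  fix k l assume kl: "k \<in> {..<12}" "l \<in> {..<12}" "rotate_column i k = rotate_column i l"
  have *: "m mod 11 \<noteq> 11" for m :: nat
    using mod_less_divisor[of 11 m] by linarith
  show "k = l"
  proof (cases "k = 11 \<or> l = 11")
    case True
    then show ?thesis using kl * * [symmetric] by (auto simp: rotate_column_def split: if_splits)
  next
    case False
    then have "(k + i) mod 11 = (l + i) mod 11" and "k < 11" "l < 11"
      using kl by (auto simp: rotate_column_def)
    then obtain a b where "k + i + 11 * a = l + i + 11 * b"
      by (auto simp: nat_mod_eq_iff)
    then show ?thesis using \<open>k < 11\<close> \<open>l < 11\<close> by presburger
  qed
qed

section \<open>Any two rows separate the blocks\<close>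

text \<open>
  The nine vectors with the given image under \<^const>\<open>coords\<close>, parametrised by two free coordinates.
  Solving for the image in row \<open>0\<close> leaves only these nine candidates to be tested in row \<open>d\<close>.
\<close>

fun fibre :: "bool \<Rightarrow> vec3 \<Rightarrow> gf3 \<Rightarrow> gf3 \<Rightarrow> vec5" where
  "fibre s (a, b, c) t u = (if s then (a, t, b, c, u) else (t, u, a - t, b - t, c))"

lemma in_fibre: "\<exists>t u. q = fibre s (coords s q) t u"
  by (cases q; cases s) (auto simp: coords_def)

text \<open>
  Suppose the blocks \<open>(k, p)\<close> and \<open>(l, p')\<close> have the same symbols in rows \<open>0\<close> and \<open>d\<close>. Then
  the difference \<open>q = p - p'\<close> satisfies \<open>A\<^sub>s q = c\<^sub>l - c\<^sub>k\<close> and the corresponding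
  equation for row \<open>d\<close>. The following condition says that only \<open>k = l\<close>, \<open>q = 0\<close> is possible.
\<close>

definition separates :: "nat \<Rightarrow> bool" where
  "separates d \<longleftrightarrow> (\<forall>k<12. \<forall>l<12. sheet k = sheet l \<longrightarrow>
     sheet (rotate_column d k) = sheet (rotate_column d l) \<longrightarrow>
     (\<forall>t u.
        coords (sheet (rotate_column d k))
            ((feedback_shift ^^ d) (fibre (sheet k) (offset l - offset k) t u))
          = offset (rotate_column d l) - offset (rotate_column d k) \<longrightarrow>
        k = l \<and> fibre (sheet k) (offset l - offset k) t u = 0))"

lemma all_less_12: "(\<forall>k<12::nat. P k) \<longleftrightarrow>
    P 11 \<and> P 10 \<and> P 9 \<and> P 8 \<and> P 7 \<and> P 6 \<and> P 5 \<and> P 4 \<and> P 3 \<and> P 2 \<and> P 1 \<and> P 0"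
  by (simp add: numeral_eq_Suc All_less_Suc)

text \<open>
  Tables with which the simplifier evaluates the condition. Column \<open>1\<close> appears as
  \<^term>\<open>Suc 0\<close>, its simplifier normal form.
\<close>

lemma sheet_table:
  "sheet 0 = False" "sheet (Suc 0) = True" "sheet 2 = False" "sheet 3 = True" "sheet 4 = True"
  "sheet 5 = True" "sheet 6 = False" "sheet 7 = False" "sheet 8 = False" "sheet 9 = True"
  "sheet 10 = False" "sheet 11 = True"
  by (simp_all add: sheet_def)

lemma offset_table:
  "offset 0 = (0, 0, 0)" "offset (Suc 0) = (0, 0, 0)" "offset 2 = (1, 1, 1)"
  "offset 3 = (0, 1, 0)" "offset 4 = (0, 0, 1)" "offset 5 = (0, 0, 0)"
  "offset 6 = (2, 0, 0)" "offset 7 = (1, 0, 0)" "offset 8 = (0, 0, 1)"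
  "offset 9 = (0, 0, 2)" "offset 10 = (0, 0, 2)" "offset 11 = (0, 2, 1)"
  by (simp_all add: offset_def)

lemma gf3_table:
  "(0 :: gf3) + 0 = 0" "(0 :: gf3) + 1 = 1" "(0 :: gf3) + 2 = 2"
  "(1 :: gf3) + 0 = 1" "(1 :: gf3) + 1 = 2" "(1 :: gf3) + 2 = 0"
  "(2 :: gf3) + 0 = 2" "(2 :: gf3) + 1 = 0" "(2 :: gf3) + 2 = 1"
  "(0 :: gf3) - 0 = 0" "(0 :: gf3) - 1 = 2" "(0 :: gf3) - 2 = 1"
  "(1 :: gf3) - 0 = 1" "(1 :: gf3) - 1 = 0" "(1 :: gf3) - 2 = 2"
  "(2 :: gf3) - 0 = 2" "(2 :: gf3) - 1 = 1" "(2 :: gf3) - 2 = 0"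
  "- (1 :: gf3) = 2" "- (2 :: gf3) = 1"
  "(0 :: gf3) = 0 \<longleftrightarrow> True" "(0 :: gf3) = 1 \<longleftrightarrow> False" "(0 :: gf3) = 2 \<longleftrightarrow> False"
  "(1 :: gf3) = 0 \<longleftrightarrow> False" "(1 :: gf3) = 1 \<longleftrightarrow> True" "(1 :: gf3) = 2 \<longleftrightarrow> False"
  "(2 :: gf3) = 0 \<longleftrightarrow> False" "(2 :: gf3) = 1 \<longleftrightarrow> False" "(2 :: gf3) = 2 \<longleftrightarrow> True"
  by simp_all

lemma feedback_shift_eq: "feedback_shift (v, w, x, y, z) = (w, x, y, z, v + w - x + y)"
  by (simp add: feedback_shift_def)

lemma coords_eq:
  "coords True (v, w, x, y, z) = (v, x, y)"
  "coords False (v, w, x, y, z) = (v + x, v + y, z)"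
  by (simp_all add: coords_def)

lemma funpow_numeral_apply: "(f ^^ numeral n) x = f ((f ^^ pred_numeral n) x)"
  by (simp add: numeral_eq_Suc)

text \<open>
  For each \<open>d\<close> the four pairs of sheets occur three times each, so there are \<open>4 \<cdot> 3\<^sup>2\<close> pairs of
  columns to compare, with nine vectors for each of them. The evaluation has two phases: the
  first one finds the columns, sheets and offsets while the vectors are still quantified, and only
  then are the vectors enumerated, by rewriting with nothing but the tables. To
  simplify expressions in bound variables over GF(3) would cost far more than the enumeration.
\<close>

\<comment> \<open>Adding \<open>1\<close> to column \<open>1\<close> yields \<open>Suc (Suc 0)\<close>, which has to be turned into \<open>2\<close> again.\<close>
lemmas column_evaluation = sheet_table offset_table rotate_column_def funpow_numeral_apply
  numeral_2_eq_2[symmetric] gf3_table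

lemmas vector_evaluation = all_gf3 fibre.simps feedback_shift_eq coords_eq gf3_table
  zero_prod_def prod.inject if_True if_False simp_thms

lemma separates_1_to_10:
  "separates 1" "separates 2" "separates 3" "separates 4" "separates 5"
  "separates 6" "separates 7" "separates 8" "separates 9" "separates 10"
  unfolding separates_def all_less_12
  by (simp add: column_evaluation del: fibre.simps, simp only: vector_evaluation)+

lemma separates: "1 \<le> d \<Longrightarrow> d \<le> 10 \<Longrightarrow> separates d"
  using separates_1_to_10 by (auto simp: numeral_eq_Suc le_Suc_eq)

lemma symbols_separate:
  assumes d: "1 \<le> d" "d \<le> 10" and kl: "k < 12" "l < 12"
    and eq: "symbol k p = symbol l p'"
    and eq_d: "symbol (rotate_column d k) ((feedback_shift ^^ d) p)
      = symbol (rotate_column d l) ((feedback_shift ^^ d) p')"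
  shows "k = l \<and> p = p'"
proof -
  let ?q = "p - p'"
  have diff: "coords s (a - b) = c' - c" if "coords s a + c = coords s b + c'" for s a b c c'
    using that by (simp add: coords_diff algebra_simps)
  have s: "sheet k = sheet l" "sheet (rotate_column d k) = sheet (rotate_column d l)"
    using eq eq_d by (auto simp: symbol_def)
  have q: "coords (sheet k) ?q = offset l - offset k"
    using eq s by (intro diff) (simp add: symbol_def)
  have "coords (sheet (rotate_column d k)) ((feedback_shift ^^ d) ?q)
      = offset (rotate_column d l) - offset (rotate_column d k)"
    unfolding feedback_shift_pow_diff using eq_d s by (intro diff) (simp add: symbol_def)
  moreover obtain t u where "?q = fibre (sheet k) (offset l - offset k) t u"
    using in_fibre[of ?q "sheet k"] q by auto
  ultimately have "k = l \<and> ?q = 0"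
    using separates[OF d] kl s unfolding separates_def by metis
  then show ?thesis by simp
qed

text \<open>
  The rows \<open>i\<close> and \<open>j\<close> at the block \<open>(k, p)\<close> are the rows \<open>0\<close> and \<open>j - i\<close> at the block
  \<open>(k + i, T\<^sup>i p)\<close>, and the passage from one block to the other is injective.
\<close>

lemma array_rows_separate:
  assumes "i < j" "j < 11"
  shows "inj_on (\<lambda>x. (array_row i x, array_row j x)) ({..<12} \<times> UNIV)"
proof (rule inj_onI)
  fix x y :: "nat \<times> vec5"
  assume "x \<in> {..<12} \<times> UNIV" "y \<in> {..<12} \<times> UNIV"
    and *: "(array_row i x, array_row j x) = (array_row i y, array_row j y)"
  then obtain k p l p' where x: "x = (k, p)" and y: "y = (l, p')" and kl: "k < 12" "l < 12"
    by (metis SigmaE lessThan_iff)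
  have eq: "array_row i (k, p) = array_row i (l, p')" "array_row j (k, p) = array_row j (l, p')"
    using * x y by auto
  define d where "d = j - i"
  have d: "1 \<le> d" "d \<le> 10" "j = i + d"
    using assms by (auto simp: d_def)
  have pow: "(feedback_shift ^^ (i + d)) r = (feedback_shift ^^ d) ((feedback_shift ^^ i) r)" for r
    by (subst add.commute) (simp add: funpow_add)
  have "rotate_column i k = rotate_column i l \<and>
      (feedback_shift ^^ i) p = (feedback_shift ^^ i) p'"
    using d kl eq
    by (intro symbols_separate[of d])
      (auto simp: array_row_def rotate_column_less rotate_column_add pow)
  then have "k = l" "p = p'"
    using kl inj_onD[OF inj_on_rotate_column] injD[OF inj_feedback_shift_pow] by blast+
  then show "x = y" using x y by simp
qed

theorem theorem1:
  shows "max_mols 54 \<ge> 8 \<and>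
    (\<exists>M :: (nat \<Rightarrow> nat \<Rightarrow> nat) set. finite M \<and> card M = 8 \<and> mols 54 M)"
proof -
  have "\<exists>M :: (nat \<Rightarrow> nat \<Rightarrow> nat) set. finite M \<and> card M = 8 \<and> mols 54 M"
  proof (rule orthogonal_array_imp_mols)
    show "card ({..<12 :: nat} \<times> (UNIV :: vec5 set)) = 54 ^ 2"
      by (simp add: card_cartesian_product)
    show "card (UNIV :: (bool \<times> vec3) set) = 54"
      by simp
    show "inj_on (\<lambda>x. (array_row i x, array_row j x)) ({..<12} \<times> UNIV)"
      if "i < j" "j < 8 + 2" for i j
      using that by (intro array_rows_separate) auto
  qed auto
  then obtain M :: "(nat \<Rightarrow> nat \<Rightarrow> nat) set" where M: "finite M" "card M = 8" "mols 54 M"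
    by blast
  then have "enat 8 \<le> max_mols 54"
    unfolding max_mols_def by (intro Sup_upper) (auto intro!: exI[of _ M])
  with M show ?thesis
    by (auto simp: numeral_eq_enat)
qed

end
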